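(* A finite group $G$ is nilpotent if and only if every generating set of $G$ invariably generates $G$.
   Context: For a finite group $G$ and $s,g\in G$ write $s^g=g^{-1}sg$. A subset $S\subseteq G$ invariably generates $G$ if $G=\langle s^{g(s)}\mid s\in S\rangle$ for every choice of elements $g(s)\in G$, $s\in S$. *)

theory Defs
  imports "HOL-Algebra.Generated_Groups"
begin

text \<open>Commutators are taken as \<open>x y x\<inverse> y\<inverse>\<close>, as in the library's derived subgroup. The
  indexing of the lower central series starts at 0, with the whole group.\<close>

definition commutator_subgroup :: "('a, 'b) monoid_scheme \<Rightarrow> 'a set \<Rightarrow> 'a set \<Rightarrow> 'a set" where
  "commutator_subgroup G H K =
     generate G {h \<otimes>\<^bsub>G\<^esub> k \<otimes>\<^bsub>G\<^esub> inv\<^bsub>G\<^esub> h \<otimes>\<^bsub>G\<^esub> inv\<^bsub>G\<^esub> k | h k. h \<in> H \<and> k \<in> K}"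

primrec lower_central :: "('a, 'b) monoid_scheme \<Rightarrow> nat \<Rightarrow> 'a set" where
  "lower_central G 0 = carrier G"
| "lower_central G (Suc n) = commutator_subgroup G (lower_central G n) (carrier G)"

definition nilpotent_group :: "('a, 'b) monoid_scheme \<Rightarrow> bool" where
  "nilpotent_group G \<longleftrightarrow> group G \<and> (\<exists>n. lower_central G n = {\<one>\<^bsub>G\<^esub>})"

definition conjugate :: "('a, 'b) monoid_scheme \<Rightarrow> 'a \<Rightarrow> 'a \<Rightarrow> 'a" where
  "conjugate G s g = inv\<^bsub>G\<^esub> g \<otimes>\<^bsub>G\<^esub> s \<otimes>\<^bsub>G\<^esub> g"

definition invariably_generates :: "('a, 'b) monoid_scheme \<Rightarrow> 'a set \<Rightarrow> bool" where
  "invariably_generates G S \<longleftrightarrow> S \<subseteq> carrier G \<and>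
     (\<forall>g \<in> S \<rightarrow> carrier G. generate G ((\<lambda>s. conjugate G s (g s)) ` S) = carrier G)"

end

theory Submission
  imports Defs "HOL-Algebra.Sylow" "HOL-Algebra.Group_Action" "HOL-Algebra.Elementary_Groups"
begin

text \<open>In a finite nilpotent group the last term of the lower central series not contained in a
  maximal subgroup \<open>M\<close> normalizes \<open>M\<close>, so maximal subgroups are normal;
  hence if the conjugates of \<open>S\<close> lie in \<open>M\<close>, so does \<open>S\<close>.
  Conversely, if generating sets generate invariably, then maximal subgroups are normal. Frattini's
  argument makes the Sylow subgroups normal, so those for different primes commute, the center is
  nontrivial, and since the hypothesis on maximal subgroups passes to quotients, the group is
  nilpotent.\<close>

subsection \<open>Actions of p-groups\<close>

text \<open>The maps of \<open>g\<close> and \<open>inv g\<close> undo each other, so bijectivity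
  need not be assumed. The restriction to \<open>E\<close> is there because the elements of
  \<open>Bij E\<close> are extensional functions.\<close>

lemma (in group) group_actionI:
  assumes closed: "\<And>g x. g \<in> carrier G \<Longrightarrow> x \<in> E \<Longrightarrow> f g x \<in> E"
    and one: "\<And>x. x \<in> E \<Longrightarrow> f \<one> x = x"
    and mult: "\<And>g h x. g \<in> carrier G \<Longrightarrow> h \<in> carrier G \<Longrightarrow> x \<in> E \<Longrightarrow> f (g \<otimes> h) x = f g (f h x)"
  shows "group_action G E (\<lambda>g. \<lambda>x\<in>E. f g x)"
proof -
  have bij: "(\<lambda>x\<in>E. f g x) \<in> Bij E" if g: "g \<in> carrier G" for g
  proof -
    have "bij_betw (f g) E E"
    proof (rule bij_betw_byWitness[where f' = "f (inv g)"])
      show "\<forall>a\<in>E. f (inv g) (f g a) = a" "\<forall>a\<in>E. f g (f (inv g) a) = a"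
        using g one mult[of "inv g" g] mult[of g "inv g"] by simp_all
    qed (use g closed in auto)
    then show ?thesis by (simp add: Bij_def)
  qed
  have "(\<lambda>g. \<lambda>x\<in>E. f g x) \<in> hom G (BijGroup E)"
    by (rule homI)
      (use bij in \<open>auto simp: BijGroup_def compose_def mult closed fun_eq_iff\<close>)
  then show ?thesis
    by (simp add: group_action_def group_hom_def group_hom_axioms_def group_BijGroup is_group)
qed

text \<open>The moved points fill whole orbits. By orbit-stabilizer each of these has size a power
  of \<open>p\<close>, and the size is not 1, so \<open>p\<close> divides every block of the
  partition.\<close>

lemma (in group_action) p_group_dvd_card_moved:
  assumes p: "prime (p :: nat)" and order: "order G = p ^ a" and fin: "finite E"
  shows "p dvd card {x \<in> E. \<exists>g\<in>carrier G. \<phi> g x \<noteq> x}" (is "p dvd card ?M")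
proof -
  interpret group G using group_hom group_hom.axioms(1) by auto
  let ?C = "orbit G \<phi> ` ?M"
  have sub: "orbit G \<phi> x \<subseteq> E" if "x \<in> E" for x
    using element_image that by (auto simp: orbit_def)
  have moved: "orbit G \<phi> x \<subseteq> ?M" if x: "x \<in> ?M" for x
  proof
    fix y assume y: "y \<in> orbit G \<phi> x"
    then have yE: "y \<in> E" using sub x by blast
    \<comment> \<open>By symmetry some \<open>g\<close> carries \<open>y\<close> to
      \<open>x\<close>, so either \<open>y = x\<close> or this \<open>g\<close> moves
      \<open>y\<close>.\<close>
    have "x \<in> orbit G \<phi> y"
      using orbit_sym[of x y] x y yE by blast
    then obtain g where g: "g \<in> carrier G" "\<phi> g y = x" by (auto simp: orbit_def)
    show "y \<in> ?M"
    proof (cases "y = x")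
      case False
      then have "\<phi> g y \<noteq> y" using g(2) by metis
      then show ?thesis using g(1) yE by blast
    qed (use x in simp)
  qed
  have union: "\<Union>?C = ?M" using moved orbit_refl by blast
  have "p dvd card (\<Union>?C)"
  proof (rule dvd_partition)
    show "finite (\<Union>?C)" using union fin by simp
    show "\<forall>c1\<in>?C. \<forall>c2\<in>?C. c1 \<noteq> c2 \<longrightarrow> c1 \<inter> c2 = {}"
    proof (intro ballI)
      fix c1 c2 assume "c1 \<in> ?C" "c2 \<in> ?C"
      then show "c1 \<noteq> c2 \<longrightarrow> c1 \<inter> c2 = {}"
        using disjoint_union[of c1 c2] by (auto simp: orbits_def)
    qed
    show "\<forall>c\<in>?C. p dvd card c"
    proof
      fix c assume "c \<in> ?C"
      then obtain x where x: "x \<in> ?M" "c = orbit G \<phi> x" by blast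
      have "card c dvd p ^ a"
        using orbit_stabilizer_theorem[of x] x order by (metis (no_types, lifting) dvd_triv_left mem_Collect_eq)
      then obtain i where i: "card c = p ^ i" using p divides_primepow_nat by blast
      have "card c \<noteq> 1"
      proof
        assume "card c = 1"
        then obtain y where c: "c = {y}" by (auto simp: card_1_singleton_iff)
        have "x \<in> c" using orbit_refl x by auto
        moreover have "\<phi> g x \<in> c" if "g \<in> carrier G" for g
          using x that by (auto simp: orbit_def)
        ultimately have "\<phi> g x = x" if "g \<in> carrier G" for g
          using that c by (metis singletonD)
        then show False using x by blast
      qed
      then show "p dvd card c" using i by (cases i) auto
    qed
  qed
  then show ?thesis using union by simp
qed

lemma (in group) subgroup_order_dvd:
  "subgroup H G \<Longrightarrow> card H dvd order G"
  using lagrange by (metis dvd_triv_right)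

lemma (in group) subgroup_eq_carrierI:
  assumes "subgroup H G" "finite (carrier G)" "order G dvd card H"
  shows "H = carrier G"
proof -
  have "H \<subseteq> carrier G" using assms(1) by (rule subgroup.subset)
  moreover have "card H \<ge> order G"
    using assms finite_subset[OF \<open>H \<subseteq> carrier G\<close>] subgroup.one_closed[OF assms(1)]
    by (metis card_gt_0_iff dvd_imp_le empty_iff)
  ultimately show ?thesis using assms(2) by (simp add: card_seteq order_def)
qed

text \<open>Let \<open>Q\<close> act on the \<open>m\<close> right cosets of \<open>P\<close>. Since
  \<open>p\<close> does not divide \<open>m\<close>, some coset \<open>P #> g\<close> is fixed, and
  being fixed by \<open>x\<close> means that \<open>g \<otimes> x \<otimes> inv g\<close> lies in
  \<open>P\<close>.\<close>

lemma (in group) p_subgroup_conj_subset_sylow: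
  assumes fin: "finite (carrier G)" and p: "prime (p :: nat)"
    and P: "subgroup P G" and index: "order G = card P * m" "\<not> p dvd m"
    and Q: "subgroup Q G" "card Q = p ^ b"
  obtains g where "g \<in> carrier G" "\<And>x. x \<in> Q \<Longrightarrow> g \<otimes> x \<otimes> inv g \<in> P"
proof -
  interpret P: subgroup P G by fact
  interpret Q: subgroup Q G by fact
  interpret QG: group "G\<lparr>carrier := Q\<rparr>" by (rule Q.subgroup_is_group[OF is_group])
  let ?E = "rcosets P"
  have PE: "P #> (x \<otimes> y) = P #> x #> y" if "x \<in> carrier G" "y \<in> carrier G" for x y
    using that P.subset by (simp add: coset_mult_assoc)
  \<comment> \<open>Multiplying by \<open>inv g\<close> on the right turns right translation into a
    left action.\<close>
  interpret act: group_action "G\<lparr>carrier := Q\<rparr>" ?E "\<lambda>g. \<lambda>X\<in>?E. X #> inv g"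
  proof (rule QG.group_actionI)
    fix g X assume "g \<in> carrier (G\<lparr>carrier := Q\<rparr>)" "X \<in> ?E"
    then show "X #> inv g \<in> ?E"
      using PE P.subset by (auto simp: RCOSETS_def) (metis Q.mem_carrier inv_closed m_closed)
  next
    fix X assume "X \<in> ?E"
    then show "X #> inv (\<one>\<^bsub>G\<lparr>carrier := Q\<rparr>\<^esub>) = X"
      using P.rcosets_carrier[OF is_group] by (simp add: coset_mult_one)
  next
    fix g h X assume "g \<in> carrier (G\<lparr>carrier := Q\<rparr>)" "h \<in> carrier (G\<lparr>carrier := Q\<rparr>)" "X \<in> ?E"
    then show "X #> inv (g \<otimes>\<^bsub>G\<lparr>carrier := Q\<rparr>\<^esub> h) = X #> inv h #> inv g"
      using P.rcosets_carrier[OF is_group] by (simp add: coset_mult_assoc inv_mult_group)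
  qed
  have "card P > 0" using fin P.subset P.one_closed by (metis card_gt_0_iff empty_iff finite_subset)
  then have cardE: "card ?E = m" using lagrange[OF P] index(1) by (simp add: mult.commute)
  have finE: "finite ?E" using fin finite_subset[OF rcosets_subset_PowG[OF P]] by simp
  have "p dvd card {X \<in> ?E. \<exists>g\<in>Q. X #> inv g \<noteq> X}"
    using act.p_group_dvd_card_moved[OF p _ finE, of b] Q(2)
    by (simp add: order_def cong: conj_cong)
  then have "{X \<in> ?E. \<exists>g\<in>Q. X #> inv g \<noteq> X} \<noteq> ?E" using cardE index(2) by auto
  then obtain X where X: "X \<in> ?E" "\<And>g. g \<in> Q \<Longrightarrow> X #> inv g = X" by blast
  then obtain g where g: "g \<in> carrier G" "X = P #> g" by (auto simp: RCOSETS_def)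
  have "g \<otimes> x \<otimes> inv g \<in> P" if "x \<in> Q" for x
  proof -
    have xG: "x \<in> carrier G" using that by (rule Q.mem_carrier)
    have "P #> (g \<otimes> x) = P #> g"
      using X(2)[of "inv x"] that g xG PE by simp
    then have "g \<otimes> x \<in> P #> g"
      using g xG rcos_self[OF _ P, of "g \<otimes> x"] by simp
    then show ?thesis
      using P.rcos_module_imp[OF is_group g(1)] by blast
  qed
  then show thesis using that g(1) by blast
qed

text \<open>The class equation: under conjugation the fixed points form the center, so
  \<open>p\<close> divides the order of the center, which therefore has more than one
  element.\<close>

lemma (in group) p_group_center_nontrivial:
  assumes p: "prime (p :: nat)" and order: "order G = p ^ a" "a > 0"
  obtains z where "z \<in> carrier G" "z \<noteq> \<one>" "\<And>x. x \<in> carrier G \<Longrightarrow> x \<otimes> z = z \<otimes> x"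
proof -
  interpret act: group_action G "carrier G" "\<lambda>g. \<lambda>x\<in>carrier G. g \<otimes> x \<otimes> inv g"
    by (rule action_by_conjugation)
  have fin: "finite (carrier G)"
    using order p by (metis order_gt_0_iff_finite prime_gt_0_nat zero_less_power)
  have fixed: "g \<otimes> x \<otimes> inv g = x \<longleftrightarrow> g \<otimes> x = x \<otimes> g" if "g \<in> carrier G" "x \<in> carrier G" for g x
    using that by (metis inv_solve_right m_closed)
  let ?M = "{x \<in> carrier G. \<exists>g\<in>carrier G. g \<otimes> x \<noteq> x \<otimes> g}"
  let ?Z = "{x \<in> carrier G. \<forall>g\<in>carrier G. g \<otimes> x = x \<otimes> g}"
  have "p dvd card ?M"
    using act.p_group_dvd_card_moved[OF p order(1) fin] by (simp add: fixed cong: conj_cong)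
  moreover have "p dvd card (carrier G)" using order by (simp add: order_def)
  moreover have "card (carrier G) = card ?M + card ?Z"
    using fin by (subst card_Un_disjoint[symmetric]) (auto intro!: arg_cong[where f = card])
  ultimately have "p dvd card ?Z" by (simp add: dvd_add_right_iff)
  moreover have "\<one> \<in> ?Z" by simp
  ultimately have "?Z \<noteq> {\<one>}"
    using p by (metis (no_types, lifting) is_singletonI is_singleton_altdef nat_dvd_1_iff_1
      not_prime_unit)
  then show thesis using that \<open>\<one> \<in> ?Z\<close> by blast
qed

subsection \<open>Normal Sylow subgroups\<close>

text \<open>The normalizer is a stabilizer, so it demands that conjugation map \<open>H\<close> onto
  \<open>H\<close>. Conjugation is injective and \<open>H\<close> is finite, so mapping into
  \<open>H\<close> suffices.\<close>

lemma (in group) mem_normalizerI: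
  assumes fin: "finite (carrier G)" and H: "H \<subseteq> carrier G"
    and g: "g \<in> carrier G" "\<And>h. h \<in> H \<Longrightarrow> g \<otimes> h \<otimes> inv g \<in> H"
  shows "g \<in> normalizer G H"
proof -
  have eq: "g <# H #> inv g = (\<lambda>h. g \<otimes> h \<otimes> inv g) ` H"
    by (auto simp: l_coset_def r_coset_def)
  have "inj_on (\<lambda>h. g \<otimes> h \<otimes> inv g) H"
    using H g(1) by (intro inj_onI) (meson conjugation_is_inj subsetD)
  then have "g <# H #> inv g = H"
    unfolding eq by (intro endo_inj_surj finite_subset[OF H fin]) (use g(2) in auto)
  then show ?thesis using g(1) H by (simp add: normalizer_def stabilizer_def)
qed

lemma (in group) normalizer_conj_closed:
  assumes H: "H \<subseteq> carrier G" and g: "g \<in> normalizer G H" and h: "h \<in> H"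
  shows "g \<otimes> h \<otimes> inv g \<in> H"
proof -
  have "g <# H #> inv g = H" using g H by (simp add: normalizer_def stabilizer_def)
  then show ?thesis using h by (force simp: l_coset_def r_coset_def)
qed

lemma (in group) subgroup_subset_normalizer:
  assumes fin: "finite (carrier G)" and H: "subgroup H G"
  shows "H \<subseteq> normalizer G H"
  using mem_normalizerI[OF fin subgroup.subset[OF H]] H
  by (meson subgroup.mem_carrier subgroup.m_closed subgroup.m_inv_closed subsetI)

lemma (in group) normalizer_eq_carrier_imp_normal:
  assumes "subgroup H G" "normalizer G H = carrier G"
  shows "H \<lhd> G"
  using assms normalizer_conj_closed[OF subgroup.subset] by (simp add: normal_inv_iff)

text \<open>For a finite group this says that all maximal subgroups are normal; the form below passes
  to quotients more easily.\<close>

definition properly_normal :: "('a, 'b) monoid_scheme \<Rightarrow> bool" where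
  "properly_normal G \<longleftrightarrow>
     (\<forall>H. subgroup H G \<and> H \<noteq> carrier G \<longrightarrow> (\<exists>N. N \<lhd> G \<and> H \<subseteq> N \<and> N \<noteq> carrier G))"

text \<open>Frattini's argument: a proper normal subgroup containing the normalizer of \<open>P\<close> would have
  to contain the whole group.\<close>

lemma (in group) sylow_normal:
  assumes fin: "finite (carrier G)" and nb: "properly_normal G" and p: "prime (p :: nat)"
    and P: "subgroup P G" "card P = p ^ a" and index: "order G = card P * m" "\<not> p dvd m"
  shows "P \<lhd> G"
proof (rule normalizer_eq_carrier_imp_normal[OF P(1)], rule ccontr)
  assume "normalizer G P \<noteq> carrier G"
  moreover have PG: "P \<subseteq> carrier G" using P(1) by (rule subgroup.subset)
  ultimately obtain N where N: "N \<lhd> G" "normalizer G P \<subseteq> N" "N \<noteq> carrier G"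
    using nb normalizer_imp_subgroup[OF PG] unfolding properly_normal_def by blast
  interpret N: normal N G by fact
  interpret NG: group "G\<lparr>carrier := N\<rparr>" by (rule N.subgroup_is_group[OF is_group])
  have PN: "P \<subseteq> N" using subgroup_subset_normalizer[OF fin P(1)] N(2) by blast
  have subN: "subgroup P (G\<lparr>carrier := N\<rparr>)"
    using P(1) PN N.subgroup_axioms by (simp add: subgroup_incl)
  \<comment> \<open>\<open>P\<close> is again a Sylow subgroup of \<open>N\<close>: its index
    \<open>k\<close> there divides \<open>m\<close> and so is prime to \<open>p\<close>.\<close>
  obtain k where k: "card N = card P * k"
    using NG.subgroup_order_dvd[OF subN] by (auto simp: order_def)
  have "order G \<noteq> 0" using fin order_gt_0_iff_finite by simp
  moreover have "card N dvd order G" by (rule subgroup_order_dvd) (rule N.subgroup_axioms)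
  ultimately have "k dvd m" using k index(1) by auto
  then have "\<not> p dvd k" using index(2) dvd_trans by blast
  have "carrier G \<subseteq> N"
  proof
    fix g assume g: "g \<in> carrier G"
    let ?Q = "g <# P #> inv g"
    have Q: "?Q = (\<lambda>h. g \<otimes> h \<otimes> inv g) ` P"
      by (auto simp: l_coset_def r_coset_def)
    have "inj_on (\<lambda>h. g \<otimes> h \<otimes> inv g) P"
      using PG g by (intro inj_onI) (meson conjugation_is_inj subsetD)
    then have "card ?Q = p ^ a" unfolding Q by (simp add: card_image P(2))
    moreover have "?Q \<subseteq> N" unfolding Q using N.inv_op_closed2 g PN by blast
    then have "subgroup ?Q (G\<lparr>carrier := N\<rparr>)"
      using subgroup_conjugation_is_surj2[OF g P(1)] N.subgroup_axioms by (simp add: subgroup_incl)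
    \<comment> \<open>The conjugate \<open>?Q\<close> lies in \<open>N\<close> by normality, so
      Sylow's theorem inside \<open>N\<close> brings it back into \<open>P\<close> by an element of
      \<open>N\<close> itself.\<close>
    ultimately obtain n where n: "n \<in> N"
      "\<And>x. x \<in> ?Q \<Longrightarrow> n \<otimes> x \<otimes> inv\<^bsub>G\<lparr>carrier := N\<rparr>\<^esub> n \<in> P"
      using NG.p_subgroup_conj_subset_sylow[OF _ p subN _ \<open>\<not> p dvd k\<close>, of ?Q a] k fin
      by (auto simp: order_def finite_subset[OF N.subset])
    have nG: "n \<in> carrier G" using n(1) by (rule N.mem_carrier)
    \<comment> \<open>The two conjugations, first by \<open>g\<close> and then by \<open>n\<close>,
      together preserve \<open>P\<close>; hence \<open>n \<otimes> g\<close> lies in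
      \<open>N\<close>, and so does \<open>g\<close>.\<close>
    have "n \<otimes> g \<in> normalizer G P"
    proof (rule mem_normalizerI[OF fin PG])
      fix h assume h: "h \<in> P"
      then have hG: "h \<in> carrier G" using PG by blast
      have "n \<otimes> (g \<otimes> h \<otimes> inv g) \<otimes> inv n \<in> P"
        using n(2)[of "g \<otimes> h \<otimes> inv g"] h n(1) N.subgroup_axioms by (simp add: Q m_inv_consistent)
      then show "n \<otimes> g \<otimes> h \<otimes> inv (n \<otimes> g) \<in> P"
        using nG g hG by (simp add: m_assoc inv_mult_group)
    qed (use nG g in simp)
    then have "n \<otimes> g \<in> N" using N(2) by blast
    then have "inv n \<otimes> (n \<otimes> g) \<in> N" using n(1) by simp
    then show "g \<in> N" using nG g by (simp add: m_assoc[symmetric])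
  qed
  then show False using N(3) N.subset by blast
qed

text \<open>The exponent may be 0, in which case \<open>P\<close> is trivial; thus every prime is
  covered, not only the divisors of the order.\<close>

lemma (in group) ex_sylow:
  assumes fin: "finite (carrier G)" and p: "prime (p :: nat)"
  obtains P m where "subgroup P G" "card P = p ^ multiplicity p (order G)"
    "order G = card P * m" "\<not> p dvd m"
proof -
  have "order G \<noteq> 0" using fin order_gt_0_iff_finite by simp
  moreover have "\<not> is_unit p" using p by (metis not_prime_unit)
  ultimately obtain m where m: "order G = p ^ multiplicity p (order G) * m" "\<not> p dvd m"
    using multiplicity_decompose' by blast
  then obtain P where "subgroup P G" "card P = p ^ multiplicity p (order G)"
    using sylow_thm[OF p is_group _ fin] by metis
  then show thesis using that m by metis
qed

text \<open>A nontrivial element of the center of a Sylow subgroup commutes with every Sylow subgroup,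
  so its centralizer has order divisible by every prime power dividing the order of the group.\<close>

lemma (in group) properly_normal_center_nontrivial:
  assumes fin: "finite (carrier G)" and nb: "properly_normal G" and nontriv: "carrier G \<noteq> {\<one>}"
  obtains z where "z \<in> carrier G" "z \<noteq> \<one>" "\<And>x. x \<in> carrier G \<Longrightarrow> x \<otimes> z = z \<otimes> x"
proof -
  have "order G \<noteq> 1" using nontriv order_one_triv_iff by blast
  have order0: "order G \<noteq> 0" using fin order_gt_0_iff_finite by simp
  obtain p where p: "prime p" "p dvd order G" using prime_factor_nat \<open>order G \<noteq> 1\<close> by blast
  obtain P m where P: "subgroup P G" "card P = p ^ multiplicity p (order G)"
    "order G = card P * m" "\<not> p dvd m"
    using ex_sylow[OF fin p(1)] by blast
  interpret P: subgroup P G by fact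
  have "multiplicity p (order G) > 0"
    using p order0 by (simp add: prime_multiplicity_gt_zero_iff)
  then obtain z where z: "z \<in> P" "z \<noteq> \<one>" "\<And>x. x \<in> P \<Longrightarrow> x \<otimes> z = z \<otimes> x"
    using group.p_group_center_nontrivial[OF P.subgroup_is_group[OF is_group] p(1)] P(2)
    by (simp add: order_def) blast
  have zG: "z \<in> carrier G" using z(1) by (rule P.mem_carrier)
  \<comment> \<open>The centralizer of \<open>z\<close>, to be shown to be the whole group.\<close>
  define C where "C = {x \<in> carrier G. x \<otimes> z = z \<otimes> x}"
  have C: "subgroup C G"
  proof (rule subgroupI)
    fix a assume "a \<in> C"
    then show "inv a \<in> C" using zG unfolding C_def
      by (auto simp: inv_solve_left' inv_solve_right' m_assoc)
        (metis inv_closed inv_solve_left inv_solve_right m_assoc m_closed)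
  next
    fix a b assume "a \<in> C" "b \<in> C"
    then show "a \<otimes> b \<in> C" using zG unfolding C_def by (auto simp: m_assoc) (metis m_assoc)
  qed (use zG in \<open>auto simp: C_def\<close>)
  \<comment> \<open>Divisibility is checked one prime \<open>q\<close> at a time: a Sylow
    \<open>q\<close>-subgroup contained in \<open>C\<close> supplies the full power of
    \<open>q\<close>.\<close>
  have "order G dvd card C"
  proof (rule multiplicity_le_imp_dvd[OF order0])
    fix q :: nat assume q: "prime q"
    obtain Q l where Q: "subgroup Q G" "card Q = q ^ multiplicity q (order G)"
      "order G = card Q * l" "\<not> q dvd l"
      using ex_sylow[OF fin q] by blast
    interpret Q: subgroup Q G by fact
    have "card C \<noteq> 0"
      using C fin by (metis card_eq_0_iff empty_iff finite_subset subgroup.one_closed subgroup.subset)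
    moreover have "\<not> is_unit q" using q by (metis not_prime_unit)
    moreover have "q ^ multiplicity q (order G) dvd card C"
    proof (cases "q = p")
      case True
      have "P \<subseteq> C" using z(3) P.subset by (auto simp: C_def)
      then show ?thesis
        using group.subgroup_order_dvd[OF subgroup.subgroup_is_group[OF C is_group], of P]
          subgroup_incl[OF P(1) C] P(2) True by (simp add: order_def)
    next
      case False
      have "card (P \<inter> Q) = 1"
      proof -
        have "subgroup (P \<inter> Q) (G\<lparr>carrier := P\<rparr>)" "subgroup (P \<inter> Q) (G\<lparr>carrier := Q\<rparr>)"
          using subgroups_Inter_pair[OF P(1) Q(1)] P(1) Q(1) by (simp_all add: subgroup_incl)
        then have "card (P \<inter> Q) dvd card P" "card (P \<inter> Q) dvd card Q"
          using group.subgroup_order_dvd[OF P.subgroup_is_group[OF is_group]]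
            group.subgroup_order_dvd[OF Q.subgroup_is_group[OF is_group]] by (auto simp: order_def)
        moreover have "coprime (card P) (card Q)"
          using P(2) Q(2) p(1) q False by (simp add: primes_coprime)
        ultimately show ?thesis using coprime_common_divisor_nat by blast
      qed
      then have "P \<inter> Q \<subseteq> {\<one>}"
        by (metis IntI P.one_closed Q.one_closed card_1_singletonE singletonD subsetI)
      \<comment> \<open>Both Sylow subgroups are normal, and normal subgroups that meet trivially
        commute elementwise.\<close>
      then have "x \<otimes> z = z \<otimes> x" if "x \<in> Q" for x
        using normal_imp_commuting[OF sylow_normal[OF fin nb p(1) P] sylow_normal[OF fin nb q Q]] z(1) that
        by metis
      then have "Q \<subseteq> C" using Q.subset by (auto simp: C_def)
      then show ?thesis
        using group.subgroup_order_dvd[OF subgroup.subgroup_is_group[OF C is_group], of Q]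
          subgroup_incl[OF Q(1) C] Q(2) by (simp add: order_def)
    qed
    ultimately show "multiplicity q (order G) \<le> multiplicity q (card C)"
      by (intro multiplicity_geI) auto
  qed
  then have "C = carrier G" using subgroup_eq_carrierI[OF C fin] by simp
  then show thesis using that zG z(2) unfolding C_def by blast
qed

text \<open>Pull \<open>H\<close> back to its preimage \<open>L\<close>, enclose \<open>L\<close> in
  a proper normal subgroup \<open>N\<close>, and push \<open>N\<close> forward. The image stays
  proper because \<open>N\<close> contains the kernel \<open>K\<close>.\<close>

lemma (in group) properly_normal_quotient:
  assumes nb: "properly_normal G" and K: "K \<lhd> G"
  shows "properly_normal (G Mod K)"
  unfolding properly_normal_def
proof (intro allI impI, elim conjE)
  fix H assume H: "subgroup H (G Mod K)" "H \<noteq> carrier (G Mod K)"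
  interpret K: normal K G by fact
  interpret Q: group "G Mod K" by (rule K.factorgroup_is_group)
  interpret H: subgroup H "G Mod K" by fact
  interpret \<pi>: group_hom G "G Mod K" "\<lambda>x. K #> x"
    by (simp add: group_hom_def group_hom_axioms_def K.r_coset_hom_Mod Q.is_group is_group)
  define L where "L = {x \<in> carrier G. K #> x \<in> H}"
  have onto: "\<exists>x\<in>carrier G. X = K #> x" if "X \<in> carrier (G Mod K)" for X
    using that by (auto simp: carrier_FactGroup)
  have "subgroup L G"
  proof (rule subgroupI)
    have "\<one> \<in> L" using \<pi>.hom_one H.one_closed by (simp add: L_def)
    then show "L \<noteq> {}" by blast
  next
    fix a assume "a \<in> L"
    then show "inv a \<in> L" using \<pi>.hom_inv[of a] H.m_inv_closed by (auto simp: L_def)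
  next
    fix a b assume "a \<in> L" "b \<in> L"
    then show "a \<otimes> b \<in> L" using \<pi>.hom_mult[of a b] H.m_closed by (auto simp: L_def)
  qed (auto simp: L_def)
  moreover have "L \<noteq> carrier G"
  proof
    assume "L = carrier G"
    then have "carrier (G Mod K) \<subseteq> H" using onto by (auto simp: L_def)
    then show False using H(2) H.subset by blast
  qed
  ultimately obtain N where N: "N \<lhd> G" "L \<subseteq> N" "N \<noteq> carrier G"
    using nb unfolding properly_normal_def by blast
  interpret N: normal N G by fact
  have "K \<subseteq> L"
  proof
    fix k assume k: "k \<in> K"
    then have "K #> k = K" by (rule K.rcos_const[OF is_group])
    then show "k \<in> L" using k K.subset H.one_closed by (auto simp: L_def)
  qed
  then have KN: "K \<subseteq> N" using N(2) by blast
  show "\<exists>M. M \<lhd> G Mod K \<and> H \<subseteq> M \<and> M \<noteq> carrier (G Mod K)"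
  proof (intro exI conjI)
    show "(\<lambda>x. K #> x) ` N \<lhd> G Mod K"
      by (rule N.surj_hom_normal_subgroup) (simp_all add: \<pi>.group_hom_axioms carrier_FactGroup)
    show "H \<subseteq> (\<lambda>x. K #> x) ` N"
    proof
      fix X assume X: "X \<in> H"
      then obtain x where "x \<in> carrier G" "X = K #> x" using onto H.mem_carrier by blast
      then show "X \<in> (\<lambda>x. K #> x) ` N" using X N(2) by (auto simp: L_def)
    qed
    show "(\<lambda>x. K #> x) ` N \<noteq> carrier (G Mod K)"
    proof
      assume eq: "(\<lambda>x. K #> x) ` N = carrier (G Mod K)"
      \<comment> \<open>Since \<open>K \<subseteq> N\<close>, an element whose coset meets
        \<open>N\<close> lies in \<open>N\<close>.\<close>
      have "carrier G \<subseteq> N"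
      proof
        fix x assume x: "x \<in> carrier G"
        then have "K #> x \<in> (\<lambda>x. K #> x) ` N" unfolding eq by (simp add: carrier_FactGroup)
        then obtain n where n: "n \<in> N" "K #> x = K #> n" by blast
        then have "x \<in> K #> n" using rcos_self[OF x K.subgroup_axioms] by simp
        then have "x \<otimes> inv n \<in> N"
          using K.rcos_module_imp[OF is_group, of n x] n(1) KN N.subset by blast
        then have "x \<otimes> inv n \<otimes> n \<in> N" using n(1) by (rule N.m_closed)
        then show "x \<in> N" using x n(1) by (simp add: m_assoc N.mem_carrier)
      qed
      then show False using N(3) N.subset by blast
    qed
  qed
qed

subsection \<open>The lower central series\<close>

lemma (in group) lower_central_subgroup: "subgroup (lower_central G n) G"
proof (induction n)
  case (Suc n)
  then interpret L: subgroup "lower_central G n" G .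
  show ?case
    by (auto simp: commutator_subgroup_def intro!: generate_is_subgroup)
qed (simp add: subgroup_self)

lemma (in group) commutator_mem_lower_central:
  assumes "x \<in> lower_central G n" "g \<in> carrier G"
  shows "x \<otimes> g \<otimes> inv x \<otimes> inv g \<in> lower_central G (Suc n)"
  using assms by (auto simp: commutator_subgroup_def intro!: generate.incl)

lemma (in group) lower_central_Suc_subsetI:
  assumes "subgroup K G"
    and "\<And>x g. x \<in> lower_central G n \<Longrightarrow> g \<in> carrier G \<Longrightarrow> x \<otimes> g \<otimes> inv x \<otimes> inv g \<in> K"
  shows "lower_central G (Suc n) \<subseteq> K"
  unfolding lower_central.simps commutator_subgroup_def
  by (rule generate_subgroup_incl) (use assms in auto)

text \<open>The cosets commute exactly when \<open>x \<otimes> g\<close> and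
  \<open>g \<otimes> x\<close> lie in one coset of \<open>H\<close>, and the quotient of these two
  products is the commutator.\<close>

lemma (in normal) rcos_commute_iff_commutator:
  assumes "x \<in> carrier G" "g \<in> carrier G"
  shows "(H #> x) <#> (H #> g) = (H #> g) <#> (H #> x) \<longleftrightarrow> x \<otimes> g \<otimes> inv x \<otimes> inv g \<in> H"
proof -
  have "(H #> x) <#> (H #> g) = (H #> g) <#> (H #> x) \<longleftrightarrow> H #> (x \<otimes> g) = H #> (g \<otimes> x)"
    using assms by (simp add: rcos_sum)
  also have "\<dots> \<longleftrightarrow> x \<otimes> g \<in> H #> (g \<otimes> x)"
    using assms subgroup_axioms rcos_self repr_independence m_closed by metis
  also have "\<dots> \<longleftrightarrow> x \<otimes> g \<otimes> inv (g \<otimes> x) \<in> H"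
    using assms by (simp add: rcos_module is_group)
  also have "x \<otimes> g \<otimes> inv (g \<otimes> x) = x \<otimes> g \<otimes> inv x \<otimes> inv g"
    using assms by (simp add: inv_mult_group m_assoc)
  finally show ?thesis .
qed

text \<open>Take \<open>K\<close> maximal among the normal subgroups such that the lower central series terminates
  boundedly soon after entering \<open>K\<close>; a nontrivial center of \<open>G Mod K\<close> would enlarge \<open>K\<close>.\<close>

lemma (in group) properly_normal_imp_nilpotent:
  assumes fin: "finite (carrier G)" and nb: "properly_normal G"
  shows "nilpotent_group G"
proof -
  \<comment> \<open>The delay \<open>n\<close> is uniform in \<open>m\<close>. The inner implication
    may be vacuous, so no term needs to be known to lie in \<open>K\<close> beforehand.\<close>
  define P where "P K \<longleftrightarrow> K \<lhd> G \<and>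
    (\<exists>n. \<forall>m. lower_central G m \<subseteq> K \<longrightarrow> lower_central G (m + n) = {\<one>})" for K
  have "lower_central G m \<subseteq> {\<one>} \<longrightarrow> lower_central G (m + 0) = {\<one>}" for m
    using subgroup.one_closed[OF lower_central_subgroup] by auto
  then have "P {\<one>}" unfolding P_def using one_is_normal by blast
  moreover have "card K < Suc (order G)" if "P K" for K
    using that fin by (auto simp: P_def order_def less_Suc_eq_le dest!: normal_imp_subgroup subgroup.subset
        intro: card_mono)
  ultimately obtain K where K: "P K" and maximal: "\<And>L. P L \<Longrightarrow> card L \<le> card K"
    using ex_has_greatest_nat[of P "{\<one>}" card "Suc (order G)"] by blast
  then obtain n where n: "\<And>m. lower_central G m \<subseteq> K \<Longrightarrow> lower_central G (m + n) = {\<one>}"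
    unfolding P_def by blast
  have "K \<lhd> G" using K unfolding P_def by blast
  then interpret K: normal K G .
  interpret Q: group "G Mod K" by (rule K.factorgroup_is_group)
  have "K = carrier G"
  proof (rule ccontr)
    assume "K \<noteq> carrier G"
    then have "carrier (G Mod K) \<noteq> {\<one>\<^bsub>G Mod K\<^esub>}"
      using K.fact_group_trivial_iff[OF fin] by simp
    moreover have "finite (carrier (G Mod K))" using fin by (simp add: carrier_FactGroup)
    ultimately obtain Z where Z: "Z \<in> carrier (G Mod K)" "Z \<noteq> K"
      "\<And>X. X \<in> carrier (G Mod K) \<Longrightarrow> X <#> Z = Z <#> X"
      using Q.properly_normal_center_nontrivial[OF _ properly_normal_quotient[OF nb \<open>K \<lhd> G\<close>]]
      by auto
    then obtain z where z: "z \<in> carrier G" "Z = K #> z" by (auto simp: carrier_FactGroup)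
    \<comment> \<open>The preimage in \<open>G\<close> of the center of
      \<open>G Mod K\<close>.\<close>
    define L where "L = {x \<in> carrier G. \<forall>g\<in>carrier G. K #> (x \<otimes> g) = K #> (g \<otimes> x)}"
    have L_iff: "x \<in> L \<longleftrightarrow> x \<in> carrier G \<and> (\<forall>g\<in>carrier G. x \<otimes> g \<otimes> inv x \<otimes> inv g \<in> K)" for x
      unfolding L_def using K.rcos_commute_iff_commutator[of x] by (auto simp: K.rcos_sum)
    have shift: "K #> (x \<otimes> y) = (K #> x) <#> (K #> y)" if "x \<in> carrier G" "y \<in> carrier G" for x y
      using that by (simp add: K.rcos_sum)
    have KL: "K \<subseteq> L"
    proof
      fix k assume k: "k \<in> K"
      have "k \<otimes> g \<otimes> inv k \<otimes> inv g \<in> K" if "g \<in> carrier G" for g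
      proof -
        have "k \<otimes> (g \<otimes> inv k \<otimes> inv g) \<in> K"
          using k that K.inv_op_closed2 by simp
        then show ?thesis using k that by (simp add: m_assoc K.mem_carrier)
      qed
      then show "k \<in> L" using k by (simp add: L_iff K.mem_carrier)
    qed
    have "subgroup L G"
    proof (rule subgroupI)
      fix a assume a: "a \<in> L"
      then have aG: "a \<in> carrier G" by (simp add: L_def)
      have "K #> (inv a \<otimes> g) = K #> (g \<otimes> inv a)" if g: "g \<in> carrier G" for g
      proof -
        \<comment> \<open>Centrality of \<open>a\<close> modulo \<open>K\<close> is applied to
          \<open>inv a \<otimes> g \<otimes> inv a\<close>, where cancelling \<open>a\<close> on
          either side leaves the two products wanted.\<close>
        have "K #> (a \<otimes> (inv a \<otimes> g \<otimes> inv a)) = K #> (inv a \<otimes> g \<otimes> inv a \<otimes> a)"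
          using a aG g by (auto simp: L_def)
        then show ?thesis using aG g by (simp add: m_assoc[symmetric]) (simp add: m_assoc)
      qed
      then show "inv a \<in> L" using aG by (simp add: L_def)
    next
      fix a b assume ab: "a \<in> L" "b \<in> L"
      then have abG: "a \<in> carrier G" "b \<in> carrier G" by (simp_all add: L_def)
      have "K #> (a \<otimes> b \<otimes> g) = K #> (g \<otimes> (a \<otimes> b))" if g: "g \<in> carrier G" for g
      proof -
        have "K #> (a \<otimes> (b \<otimes> g)) = K #> (b \<otimes> g \<otimes> a)" using ab abG g by (auto simp: L_def)
        also have "\<dots> = K #> (b \<otimes> (g \<otimes> a))" using abG g by (simp add: m_assoc)
        also have "\<dots> = K #> (g \<otimes> a \<otimes> b)" using ab abG g by (auto simp: L_def)
        finally show ?thesis using abG g by (simp add: m_assoc)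
      qed
      then show "a \<otimes> b \<in> L" using abG by (simp add: L_def)
    qed (use KL K.one_closed in \<open>auto simp: L_def\<close>)
    \<comment> \<open>A conjugate of \<open>h\<close> differs from \<open>h\<close> by a commutator,
      which lies in \<open>K\<close> and hence in \<open>L\<close>.\<close>
    moreover have "x \<otimes> h \<otimes> inv x \<in> L" if x: "x \<in> carrier G" and h: "h \<in> L" for x h
    proof -
      have hG: "h \<in> carrier G" using h by (simp add: L_def)
      have "h \<otimes> x \<otimes> inv h \<otimes> inv x \<in> K" using h x by (simp add: L_iff)
      then have "inv (h \<otimes> x \<otimes> inv h \<otimes> inv x) \<in> L" using KL by blast
      moreover have "x \<otimes> h \<otimes> inv x = inv (h \<otimes> x \<otimes> inv h \<otimes> inv x) \<otimes> h"
        using x hG by (simp add: inv_mult_group m_assoc)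
      ultimately show ?thesis using \<open>subgroup L G\<close> h subgroup.m_closed by metis
    qed
    ultimately have "L \<lhd> G" by (simp add: normal_inv_iff)
    \<comment> \<open>Commutators of \<open>L\<close> with \<open>G\<close> lie in \<open>K\<close>,
      so one further step leads from \<open>L\<close> into \<open>K\<close> and the delay grows from
      \<open>n\<close> to \<open>Suc n\<close>.\<close>
    moreover have "lower_central G (m + Suc n) = {\<one>}" if "lower_central G m \<subseteq> L" for m
    proof -
      have "lower_central G (Suc m) \<subseteq> K"
        by (rule lower_central_Suc_subsetI) (use that L_iff K.subgroup_axioms in blast)+
      then show ?thesis using n[of "Suc m"] by simp
    qed
    ultimately have "P L" unfolding P_def by blast
    then have "card L \<le> card K" by (rule maximal)
    then have "K = L"
      using card_seteq[OF _ KL] fin finite_subset[of L "carrier G"] by (auto simp: L_def)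
    moreover have "z \<in> L"
      using Z(3) z by (auto simp: L_def shift carrier_FactGroup)
    ultimately have "Z = K" using z K.rcos_const[OF is_group] by simp
    then show False using Z(2) by simp
  qed
  \<comment> \<open>The term of index 0 is the whole group, now equal to \<open>K\<close>, so the
    delay \<open>n\<close> is itself an index at which the series is trivial.\<close>
  then have "lower_central G (0 + n) = {\<one>}" by (intro n) simp
  then show ?thesis unfolding nilpotent_group_def using is_group by blast
qed

subsection \<open>Maximal subgroups and invariable generation\<close>

text \<open>Choose a proper subgroup above \<open>H\<close> of largest cardinality; any subgroup
  above it contains \<open>H\<close> as well, so it cannot be both larger and proper.\<close>

lemma (in group) ex_maximal_subgroup:
  assumes fin: "finite (carrier G)" and H: "subgroup H G" "H \<noteq> carrier G"
  obtains M where "subgroup M G" "H \<subseteq> M" "M \<noteq> carrier G"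
    "\<And>K. subgroup K G \<Longrightarrow> M \<subset> K \<Longrightarrow> K = carrier G"
proof -
  define P where "P K \<longleftrightarrow> subgroup K G \<and> H \<subseteq> K \<and> K \<noteq> carrier G" for K
  have "P H" using H by (simp add: P_def)
  moreover have "card K < Suc (order G)" if "P K" for K
    using that fin by (auto simp: P_def order_def less_Suc_eq_le dest!: subgroup.subset intro: card_mono)
  ultimately obtain M where M: "P M" and maximal: "\<And>K. P K \<Longrightarrow> card K \<le> card M"
    using ex_has_greatest_nat[of P H card "Suc (order G)"] by blast
  have "K = carrier G" if K: "subgroup K G" "M \<subset> K" for K
  proof (rule ccontr)
    assume "K \<noteq> carrier G"
    then have "card K \<le> card M" using K M by (intro maximal) (auto simp: P_def)
    moreover have "finite K" using fin K(1) finite_subset subgroup.subset by blast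
    ultimately show False using psubset_card_mono[OF _ K(2)] by simp
  qed
  then show thesis using that M unfolding P_def by blast
qed

text \<open>Let \<open>i\<close> be the first index whose term lies in \<open>M\<close>. An element
  \<open>x\<close> of the preceding term outside \<open>M\<close> has its commutators with
  \<open>M\<close> inside \<open>M\<close>, so it normalizes \<open>M\<close>. The normalizer is
  then strictly larger than \<open>M\<close>, hence everything.\<close>

lemma (in group) nilpotent_maximal_subgroup_normal:
  assumes fin: "finite (carrier G)" and nil: "nilpotent_group G"
    and M: "subgroup M G" "M \<noteq> carrier G" "\<And>K. subgroup K G \<Longrightarrow> M \<subset> K \<Longrightarrow> K = carrier G"
  shows "M \<lhd> G"
proof -
  interpret M: subgroup M G by fact
  obtain n where "lower_central G n = {\<one>}" using nil by (auto simp: nilpotent_group_def)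
  then have ex: "lower_central G n \<subseteq> M" by simp
  define i where "i = (LEAST i. lower_central G i \<subseteq> M)"
  have i: "lower_central G i \<subseteq> M" unfolding i_def using ex by (rule LeastI)
  \<comment> \<open>The term of index 0 is the whole group, so a preceding term exists.\<close>
  have "i \<noteq> 0" using i M(2) M.subset by auto
  then obtain j where j: "i = Suc j" by (cases i) auto
  have "\<not> lower_central G j \<subseteq> M"
    using not_less_Least[of j "\<lambda>i. lower_central G i \<subseteq> M"] j i_def by simp
  then obtain x where x: "x \<in> lower_central G j" "x \<notin> M" by blast
  have xG: "x \<in> carrier G" using x(1) lower_central_subgroup subgroup.mem_carrier by metis
  have "x \<in> normalizer G M"
  proof (rule mem_normalizerI[OF fin M.subset xG])
    fix h assume h: "h \<in> M"
    then have "x \<otimes> h \<otimes> inv x \<otimes> inv h \<in> M"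
      using commutator_mem_lower_central[OF x(1)] i j by (metis M.mem_carrier subsetD)
    then have "x \<otimes> h \<otimes> inv x \<otimes> inv h \<otimes> h \<in> M" using h by (rule M.m_closed)
    then show "x \<otimes> h \<otimes> inv x \<in> M" using xG h by (simp add: m_assoc M.mem_carrier)
  qed
  then have "M \<subset> normalizer G M" using subgroup_subset_normalizer[OF fin M(1)] x(2) by blast
  then have "normalizer G M = carrier G" by (rule M(3)[OF normalizer_imp_subgroup[OF M.subset]])
  then show ?thesis by (rule normalizer_eq_carrier_imp_normal[OF M(1)])
qed

text \<open>If the conjugates failed to generate, they would lie in a maximal subgroup. That
  subgroup is normal, so each conjugation can be undone inside it, and it would contain
  \<open>S\<close>.\<close>

lemma (in group) nilpotent_imp_invariably_generates:
  assumes fin: "finite (carrier G)" and nil: "nilpotent_group G"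
    and S: "S \<subseteq> carrier G" "generate G S = carrier G"
  shows "invariably_generates G S"
  unfolding invariably_generates_def
proof (intro conjI ballI S(1))
  fix g assume g: "g \<in> S \<rightarrow> carrier G"
  let ?T = "(\<lambda>s. conjugate G s (g s)) ` S"
  have T: "?T \<subseteq> carrier G" using g S(1) by (auto simp: conjugate_def)
  show "generate G ?T = carrier G"
  proof (rule ccontr)
    assume "generate G ?T \<noteq> carrier G"
    then obtain M where M: "subgroup M G" "generate G ?T \<subseteq> M" "M \<noteq> carrier G"
      "\<And>K. subgroup K G \<Longrightarrow> M \<subset> K \<Longrightarrow> K = carrier G"
      using ex_maximal_subgroup[OF fin generate_is_subgroup[OF T]] by metis
    interpret M: normal M G
      using nilpotent_maximal_subgroup_normal[OF fin nil M(1,3,4)] .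
    have "s \<in> M" if s: "s \<in> S" for s
    proof -
      have gs: "g s \<in> carrier G" "s \<in> carrier G" using g s S(1) by auto
      have "inv (g s) \<otimes> s \<otimes> g s \<in> M"
        using M(2) s by (auto simp: conjugate_def intro!: generate.incl)
      then have "g s \<otimes> (inv (g s) \<otimes> s \<otimes> g s) \<otimes> inv (g s) \<in> M"
        by (rule M.inv_op_closed2[OF gs(1)])
      then show ?thesis using conjugation_is_surj[OF gs] by simp
    qed
    then have "generate G S \<subseteq> M" using M(1) by (intro generate_subgroup_incl) auto
    then show False using S(2) M(3) M.subset by simp
  qed
qed

text \<open>A maximal subgroup \<open>M\<close> together with a conjugate, outside \<open>M\<close>, of some \<open>h \<in> M\<close> is a
  generating set; conjugating that element back to \<open>h\<close> leaves only \<open>M\<close>.\<close>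

lemma (in group) invariably_generates_imp_properly_normal:
  assumes fin: "finite (carrier G)"
    and inv_gen: "\<And>S. S \<subseteq> carrier G \<Longrightarrow> generate G S = carrier G \<Longrightarrow> invariably_generates G S"
  shows "properly_normal G"
  unfolding properly_normal_def
proof (intro allI impI, elim conjE)
  fix H assume "subgroup H G" "H \<noteq> carrier G"
  then obtain M where M: "subgroup M G" "H \<subseteq> M" "M \<noteq> carrier G"
    "\<And>K. subgroup K G \<Longrightarrow> M \<subset> K \<Longrightarrow> K = carrier G"
    using ex_maximal_subgroup[OF fin] by metis
  interpret M: subgroup M G by fact
  have "x \<otimes> h \<otimes> inv x \<in> M" if x: "x \<in> carrier G" and h: "h \<in> M" for x h
  proof (rule ccontr)
    let ?y = "x \<otimes> h \<otimes> inv x"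
    assume y: "?y \<notin> M"
    have hG: "h \<in> carrier G" using h by (rule M.mem_carrier)
    let ?S = "insert ?y M"
    have S: "?S \<subseteq> carrier G" using x hG M.subset by auto
    have "M \<subset> generate G ?S" using y generate.incl[of _ ?S G] by blast
    then have "generate G ?S = carrier G" by (rule M(4)[OF generate_is_subgroup[OF S]])
    then have "invariably_generates G ?S" by (rule inv_gen[OF S])
    \<comment> \<open>As \<open>conjugate\<close> puts the inverse on the left, \<open>x\<close>
      takes \<open>?y\<close> back to \<open>h\<close>, while \<open>\<one>\<close> leaves the
      elements of \<open>M\<close> alone.\<close>
    moreover define g where "g s = (if s = ?y then x else \<one>)" for s
    moreover have "g \<in> ?S \<rightarrow> carrier G" using x by (simp add: g_def)
    ultimately have "generate G ((\<lambda>s. conjugate G s (g s)) ` ?S) = carrier G"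
      unfolding invariably_generates_def by blast
    moreover have "(\<lambda>s. conjugate G s (g s)) ` ?S \<subseteq> M"
    proof -
      have "conjugate G ?y (g ?y) = h"
        using conjugation_is_surj[of "inv x" h] x hG by (simp add: conjugate_def g_def)
      moreover have "conjugate G s (g s) = s" if "s \<in> M" for s
        using that y M.mem_carrier[OF that] by (auto simp: conjugate_def g_def)
      ultimately show ?thesis using h by auto
    qed
    then have "generate G ((\<lambda>s. conjugate G s (g s)) ` ?S) \<subseteq> M"
      using M(1) by (rule generate_subgroup_incl)
    ultimately show False using M(3) M.subset by simp
  qed
  then have "M \<lhd> G" using M(1) by (simp add: normal_inv_iff)
  then show "\<exists>N. N \<lhd> G \<and> H \<subseteq> N \<and> N \<noteq> carrier G" using M(2,3) by blast
qed

theorem proposition2p4: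
  fixes G (structure)
  assumes "group G" and "finite (carrier G)"
  shows "nilpotent_group G \<longleftrightarrow>
    (\<forall>S. S \<subseteq> carrier G \<and> generate G S = carrier G \<longrightarrow> invariably_generates G S)"
proof -
  interpret group G by fact
  show ?thesis
    using nilpotent_imp_invariably_generates[OF assms(2)]
      properly_normal_imp_nilpotent[OF assms(2) invariably_generates_imp_properly_normal[OF assms(2)]]
    by blast
qed

end
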